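(* For every integer $n\ge 3$, $D_{\min}(K_{1,n})=D'_{\min}(K_{1,n})=\lceil n/2\rceil$, $D_{\max}(K_{1,n})=D'_{\max}(K_{1,n})=n$, $\chi_{D,\min}(K_{1,n})=1+\lceil n/2\rceil$, $\chi_{D,\max}(K_{1,n})=n+1$, and $\chi'_{D,\min}(K_{1,n})=\chi'_{D,\max}(K_{1,n})=n$, where $K_{1,n}$ is the star with $n$ leaves.
   Context: An orientation of a simple graph assigns one direction to each edge. An automorphism of an oriented graph is a permutation $\phi$ of its vertices such that $\phi(u)\phi(v)$ is an arc whenever $uv$ is an arc. An $r$-vertex-labelling maps vertices to $\{1,\dots,r\}$, an $r$-arc-labelling maps arcs to $\{1,\dots,r\}$; colourings are proper labellings (adjacent vertices, resp. arcs sharing an end-vertex, get distinct labels). A labelling $\lambda$ is distinguishing if the only automorphism $\phi$ with $\lambda(\phi(u))=\lambda(u)$ for all vertices (resp. $\lambda(\phi(u)\phi(v))=\lambda(uv)$ for all arcs) is the identity. For an oriented graph $\vec G$, $D(\vec G)$, $\chi_D(\vec G)$, $D'(\vec G)$, $\chi'_D(\vec G)$ are the least $r$ for which $\vec G$ admits a distinguishing $r$-vertex-labelling, $r$-vertex-colouring, $r$-arc-labelling, $r$-arc-colouring. For an undirected graph $G$, $D_{\min}(G)$ and $D_{\max}(G)$ are the minimum and maximum of $D(\vec G)$ over all orientations $\vec G$ of $G$; analogously $\chi_{D,\min},\chi_{D,\max}$ for $\chi_D$, $D'_{\min},D'_{\max}$ for $D'$, and $\chi'_{D,\min},\chi'_{D,\max}$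 for $\chi'_D$. *)

theory Defs
  imports Complex_Main "HOL-Combinatorics.Permutations" "Graph_Theory.Kuratowski"
begin

text \<open>
  As in \<^theory>\<open>Graph_Theory.Kuratowski\<close>, an undirected simple graph is a symmetric loop-free
  digraph: the edge between \<open>u\<close> and \<open>v\<close> is the pair of arcs \<open>(u, v)\<close>, \<open>(v, u)\<close>. Oriented graphs
  have the same type, but contain at most one arc of each such pair.
\<close>

definition orientation :: "'a pair_pre_digraph \<Rightarrow> 'a pair_pre_digraph \<Rightarrow> bool" where
  "orientation G D \<longleftrightarrow>
     pverts D = pverts G \<and> parcs D \<subseteq> parcs G \<and>
     (\<forall>(u, v) \<in> parcs G. (u, v) \<in> parcs D \<longleftrightarrow> (v, u) \<notin> parcs D)"

text \<open>
  Permutations in the sense of \<^const>\<open>permutes\<close> fix everything outside the vertex set, so the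
  trivial automorphism is exactly \<^const>\<open>id\<close>.
\<close>

definition automorphism :: "'a pair_pre_digraph \<Rightarrow> ('a \<Rightarrow> 'a) \<Rightarrow> bool" where
  "automorphism D \<phi> \<longleftrightarrow>
     \<phi> permutes pverts D \<and> (\<forall>(u, v) \<in> parcs D. (\<phi> u, \<phi> v) \<in> parcs D)"


subsection \<open>Vertex labellings\<close>

definition vertex_labelling :: "'a pair_pre_digraph \<Rightarrow> nat \<Rightarrow> ('a \<Rightarrow> nat) \<Rightarrow> bool" where
  "vertex_labelling D r l \<longleftrightarrow> l ` pverts D \<subseteq> {1..r}"

definition vertex_colouring :: "'a pair_pre_digraph \<Rightarrow> nat \<Rightarrow> ('a \<Rightarrow> nat) \<Rightarrow> bool" where
  "vertex_colouring D r l \<longleftrightarrow>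
     vertex_labelling D r l \<and> (\<forall>(u, v) \<in> parcs D. l u \<noteq> l v)"

definition vertex_distinguishing :: "'a pair_pre_digraph \<Rightarrow> ('a \<Rightarrow> nat) \<Rightarrow> bool" where
  "vertex_distinguishing D l \<longleftrightarrow>
     (\<forall>\<phi>. automorphism D \<phi> \<and> (\<forall>u \<in> pverts D. l (\<phi> u) = l u) \<longrightarrow> \<phi> = id)"


subsection \<open>Arc labellings\<close>

definition arc_labelling :: "'a pair_pre_digraph \<Rightarrow> nat \<Rightarrow> ('a \<times> 'a \<Rightarrow> nat) \<Rightarrow> bool" where
  "arc_labelling D r l \<longleftrightarrow> l ` parcs D \<subseteq> {1..r}"

definition arc_colouring :: "'a pair_pre_digraph \<Rightarrow> nat \<Rightarrow> ('a \<times> 'a \<Rightarrow> nat) \<Rightarrow> bool" where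
  "arc_colouring D r l \<longleftrightarrow>
     arc_labelling D r l \<and>
     (\<forall>e \<in> parcs D. \<forall>f \<in> parcs D.
        e \<noteq> f \<and> {fst e, snd e} \<inter> {fst f, snd f} \<noteq> {} \<longrightarrow> l e \<noteq> l f)"

definition arc_distinguishing :: "'a pair_pre_digraph \<Rightarrow> ('a \<times> 'a \<Rightarrow> nat) \<Rightarrow> bool" where
  "arc_distinguishing D l \<longleftrightarrow>
     (\<forall>\<phi>. automorphism D \<phi> \<and> (\<forall>(u, v) \<in> parcs D. l (\<phi> u, \<phi> v) = l (u, v)) \<longrightarrow> \<phi> = id)"


subsection \<open>Distinguishing parameters\<close>

text \<open>
  A finite oriented graph always has a distinguishing vertex colouring. It has a distinguishing
  arc colouring provided it has at most one isolated vertex; otherwise the two arc parameters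
  below carry no information.
\<close>

definition dist_number :: "'a pair_pre_digraph \<Rightarrow> nat" where
  "dist_number D = (LEAST r. \<exists>l. vertex_labelling D r l \<and> vertex_distinguishing D l)"

definition dist_chromatic_number :: "'a pair_pre_digraph \<Rightarrow> nat" where
  "dist_chromatic_number D = (LEAST r. \<exists>l. vertex_colouring D r l \<and> vertex_distinguishing D l)"

definition dist_index :: "'a pair_pre_digraph \<Rightarrow> nat" where
  "dist_index D = (LEAST r. \<exists>l. arc_labelling D r l \<and> arc_distinguishing D l)"

definition dist_chromatic_index :: "'a pair_pre_digraph \<Rightarrow> nat" where
  "dist_chromatic_index D = (LEAST r. \<exists>l. arc_colouring D r l \<and> arc_distinguishing D l)"

definition orient_min :: "('a pair_pre_digraph \<Rightarrow> nat) \<Rightarrow> 'a pair_pre_digraph \<Rightarrow> nat" where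
  "orient_min p G = Min (p ` {D. orientation G D})"

definition orient_max :: "('a pair_pre_digraph \<Rightarrow> nat) \<Rightarrow> 'a pair_pre_digraph \<Rightarrow> nat" where
  "orient_max p G = Max (p ` {D. orientation G D})"

abbreviation "D_min \<equiv> orient_min dist_number"
abbreviation "D_max \<equiv> orient_max dist_number"
abbreviation "D'_min \<equiv> orient_min dist_index"
abbreviation "D'_max \<equiv> orient_max dist_index"
abbreviation "chi_D_min \<equiv> orient_min dist_chromatic_number"
abbreviation "chi_D_max \<equiv> orient_max dist_chromatic_number"
abbreviation "chi'_D_min \<equiv> orient_min dist_chromatic_index"
abbreviation "chi'_D_max \<equiv> orient_max dist_chromatic_index"

text \<open>\<^const>\<open>Min\<close> and \<^const>\<open>Max\<close> are meaningful above: a finite graph has finitely many orientations.\<close>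

lemma finite_orientations:
  assumes "pair_graph G"
  shows "finite {D. orientation G D}"
proof -
  interpret pair_graph G by (rule assms)
  have "{D. orientation G D}
      \<subseteq> (\<lambda>A. \<lparr>pverts = pverts G, parcs = A\<rparr>) ` Pow (parcs G)"
  proof
    fix D assume "D \<in> {D. orientation G D}"
    then have "D = \<lparr>pverts = pverts G, parcs = parcs D\<rparr>" "parcs D \<in> Pow (parcs G)"
      by (auto simp: orientation_def)
    then show "D \<in> (\<lambda>A. \<lparr>pverts = pverts G, parcs = A\<rparr>) ` Pow (parcs G)" by blast
  qed
  then show ?thesis
    using pair_finite_arcs by (meson finite_Pow_iff finite_imageI finite_subset)
qed

lemma star_exists: "\<exists>G :: nat pair_pre_digraph. K\<^bsub>1,n\<^esub> (with_proj G)"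
proof -
  let ?G = "\<lparr>pverts = {0} \<union> {1..n}, parcs = {0} \<times> {1..n} \<union> {1..n} \<times> {0}\<rparr> :: nat pair_pre_digraph"
  have "{0} \<inter> {1..n} = {}" "card {0::nat} = 1" "card {1..n} = n" by auto
  then have "K\<^bsub>1,n\<^esub> (with_proj ?G)"
    unfolding complete_bipartite_digraph_pair_def pair_pre_digraph.simps by blast
  then show ?thesis ..
qed

end

theory Submission
  imports Defs
begin

text \<open>
  An orientation of the star splits the leaves into the out-neighbours \<open>A\<close> and the in-neighbours
  \<open>B\<close> of the centre. With at least three leaves, the centre is the only vertex of in-degree or
  out-degree at least two, so the automorphisms are exactly the permutations of \<open>A\<close> combined with
  those of \<open>B\<close>. Arcs correspond to leaves, so a vertex or arc labelling is distinguishing iff the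
  induced labelling of the leaves is injective on \<open>A\<close> and on \<open>B\<close>. Hence each parameter is a monotone
  function of \<open>max (card A) (card B)\<close>, which ranges from \<open>\<lceil>n / 2\<rceil>\<close> to \<open>n\<close>.
\<close>

section \<open>Oriented stars and the number of labels needed on two disjoint parts\<close>

definition oriented_star :: "'a \<Rightarrow> 'a set \<Rightarrow> 'a set \<Rightarrow> 'a pair_pre_digraph" where
  "oriented_star c A B = \<lparr>pverts = insert c (A \<union> B), parcs = {c} \<times> A \<union> B \<times> {c}\<rparr>"

lemma pverts_oriented_star [simp]: "pverts (oriented_star c A B) = insert c (A \<union> B)"
  and parcs_oriented_star [simp]: "parcs (oriented_star c A B) = {c} \<times> A \<union> B \<times> {c}"
  by (simp_all add: oriented_star_def)

lemma ex_inj_on_atLeastAtMost: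
  fixes r :: nat
  assumes "finite S" "card S \<le> r"
  shows "\<exists>f. f ` S \<subseteq> {1..r} \<and> inj_on f S"
  using card_le_inj[of S "{1..r}"] assms by auto

text \<open>The two parts may reuse the same labels, so only the larger one bounds \<open>r\<close>;
  disjointness lets two separate injections be glued.\<close>

lemma ex_labelling_inj_on_parts:
  assumes "finite A" "finite B" "A \<inter> B = {}"
  shows "(\<exists>f. f ` (A \<union> B) \<subseteq> {1..r::nat} \<and> inj_on f A \<and> inj_on f B)
           \<longleftrightarrow> max (card A) (card B) \<le> r"
proof
  assume "\<exists>f. f ` (A \<union> B) \<subseteq> {1..r} \<and> inj_on f A \<and> inj_on f B"
  then obtain f where f: "f ` A \<subseteq> {1..r}" "f ` B \<subseteq> {1..r}" "inj_on f A" "inj_on f B"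
    by (auto simp: image_Un)
  have "card A \<le> card {1..r}" "card B \<le> card {1..r}"
    by (rule card_inj_on_le[OF f(3,1)], simp, rule card_inj_on_le[OF f(4,2)], simp)
  then show "max (card A) (card B) \<le> r" by simp
next
  assume "max (card A) (card B) \<le> r"
  then obtain f g where fg: "f ` A \<subseteq> {1..r}" "inj_on f A" "g ` B \<subseteq> {1..r}" "inj_on g B"
    using ex_inj_on_atLeastAtMost[of A r] ex_inj_on_atLeastAtMost[of B r] assms by auto
  let ?h = "\<lambda>x. if x \<in> A then f x else g x"
  have eq: "\<And>x. x \<in> B \<Longrightarrow> ?h x = g x" using assms by auto
  have "inj_on ?h A" using fg(2) by (simp cong: inj_on_cong)
  moreover have "inj_on ?h B" using inj_on_cong[of B ?h g, OF eq] fg(4) by blast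
  moreover have "?h ` (A \<union> B) \<subseteq> {1..r}" using fg(1,3) by auto
  ultimately show "\<exists>f. f ` (A \<union> B) \<subseteq> {1..r} \<and> inj_on f A \<and> inj_on f B" by blast
qed

section \<open>Automorphisms and distinguishing labellings of one oriented star\<close>

locale star_orientation =
  fixes c :: 'a and A B :: "'a set"
  assumes finite_parts: "finite A" "finite B"
    and disjoint_parts: "A \<inter> B = {}"
    and centre_notin: "c \<notin> A" "c \<notin> B"
    and three_leaves: "3 \<le> card A + card B"
begin

abbreviation D where "D \<equiv> oriented_star c A B"

text \<open>Turns an arc labelling \<open>l\<close> into the leaf labelling
  \<open>l \<circ> arc_at\<close>, so that vertex and arc labellings fall under one criterion. On a
  leaf outside \<open>A\<close>, the arc is the one entering the centre.\<close>

definition arc_at :: "'a \<Rightarrow> 'a \<times> 'a" where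
  "arc_at v = (if v \<in> A then (c, v) else (v, c))"

lemma parcs_eq_arc_at: "parcs D = arc_at ` (A \<union> B)"
  using disjoint_parts by (auto simp: arc_at_def image_iff)

lemma inj_on_arc_at: "inj_on arc_at (A \<union> B)"
  using centre_notin by (auto simp: arc_at_def inj_on_def split: if_splits)

text \<open>Every arc has \<open>c\<close> as an end. If \<open>\<phi> c \<noteq> c\<close>, the
  image of each arc has \<open>\<phi> c\<close> at one end, so \<open>c\<close> must be its other
  end; thus the injective \<open>\<phi>\<close> sends all leaves to the single vertex
  \<open>c\<close>.\<close>

lemma automorphism_fixes_centre:
  assumes "automorphism D \<phi>"
  shows "\<phi> c = c"
proof (rule ccontr)
  assume moved: "\<phi> c \<noteq> c"
  have inj: "inj \<phi>" using assms permutes_inj by (auto simp: automorphism_def)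
  have arcs: "\<And>v. v \<in> A \<Longrightarrow> (\<phi> c, \<phi> v) \<in> parcs D" "\<And>v. v \<in> B \<Longrightarrow> (\<phi> v, \<phi> c) \<in> parcs D"
    using assms unfolding automorphism_def by fastforce+
  have "\<phi> v = c" if "v \<in> A \<union> B" for v using that arcs moved by fastforce
  then have "inj_on \<phi> (A \<union> B)" "\<phi> ` (A \<union> B) \<subseteq> {c}"
    using inj by (auto intro: inj_on_subset)
  then have "card (A \<union> B) \<le> card {c}" by (intro card_inj_on_le) auto
  then show False
    using three_leaves card_Un_disjoint[OF finite_parts disjoint_parts] by simp
qed

text \<open>Once the centre is fixed, arcs leaving it go to arcs leaving it and arcs entering it to
  arcs entering it, because \<open>c\<close> is in neither part.\<close>

lemma automorphism_iff:
  "automorphism D \<phi> \<longleftrightarrow> \<phi> permutes insert c (A \<union> B) \<and> \<phi> c = c \<and> \<phi> ` A \<subseteq> A \<and> \<phi> ` B \<subseteq> B"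
  (is "?L \<longleftrightarrow> ?R")
proof
  assume L: ?L
  have fix_c: "\<phi> c = c" by (rule automorphism_fixes_centre[OF L])
  have "\<phi> permutes insert c (A \<union> B)"
    and "\<And>v. v \<in> A \<Longrightarrow> (\<phi> c, \<phi> v) \<in> parcs D" "\<And>v. v \<in> B \<Longrightarrow> (\<phi> v, \<phi> c) \<in> parcs D"
    using L unfolding automorphism_def by fastforce+
  then show ?R using fix_c centre_notin by auto
next
  assume ?R
  then show ?L by (auto simp: automorphism_def)
qed

text \<open>Two leaves of one part with equal labels can be transposed. Conversely, a
  label-preserving automorphism stays inside each part, where injectivity leaves it no choice. The
  leaf labelling \<open>f\<close> is arbitrary, so that both \<open>l\<close> and
  \<open>l \<circ> arc_at\<close> can be inserted.\<close>

lemma distinguishing_iff_inj_on: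
  "(\<forall>\<phi>. automorphism D \<phi> \<and> (\<forall>v\<in>A \<union> B. f (\<phi> v) = f v) \<longrightarrow> \<phi> = id)
     \<longleftrightarrow> inj_on f A \<and> inj_on f B"
  (is "?L \<longleftrightarrow> ?R")
proof
  assume L: ?L
  have "x = y" if xy: "f x = f y" "x \<in> A \<and> y \<in> A \<or> x \<in> B \<and> y \<in> B" for x y
  proof -
    let ?\<tau> = "transpose x y"
    have "?\<tau> permutes insert c (A \<union> B)" using xy by (auto intro: permutes_swap_id)
    moreover have "?\<tau> c = c" using xy centre_notin by (auto simp: transpose_def)
    moreover have "?\<tau> ` A \<subseteq> A" "?\<tau> ` B \<subseteq> B"
      using xy disjoint_parts by (auto simp: transpose_def)
    moreover have "\<forall>v\<in>A \<union> B. f (?\<tau> v) = f v" using xy by (auto simp: transpose_def)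
    ultimately have "?\<tau> = id" using L automorphism_iff by blast
    then show "x = y" by (metis id_apply transpose_apply_first)
  qed
  then show ?R by (auto intro!: inj_onI)
next
  assume R: ?R
  show ?L
  proof (intro allI impI ext, elim conjE)
    fix \<phi> v assume aut: "automorphism D \<phi>" and pres: "\<forall>v\<in>A \<union> B. f (\<phi> v) = f v"
    show "\<phi> v = id v"
    proof (cases "v \<in> A \<union> B")
      case True
      then show ?thesis
        using R pres aut unfolding automorphism_iff inj_on_def image_subset_iff by (metis UnE id_apply)
    next
      case False
      then show ?thesis
        using aut unfolding automorphism_iff by (cases "v = c") (auto simp: permutes_not_in)
    qed
  qed
qed

text \<open>The label of the centre imposes no condition, since every automorphism fixes the
  centre.\<close>

lemma vertex_distinguishing_iff: "vertex_distinguishing D l \<longleftrightarrow> inj_on l A \<and> inj_on l B"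
proof -
  have "(\<forall>u\<in>pverts D. l (\<phi> u) = l u) \<longleftrightarrow> (\<forall>v\<in>A \<union> B. l (\<phi> v) = l v)"
    if "automorphism D \<phi>" for \<phi>
    using automorphism_fixes_centre[OF that] by auto
  then have "vertex_distinguishing D l \<longleftrightarrow>
      (\<forall>\<phi>. automorphism D \<phi> \<and> (\<forall>v\<in>A \<union> B. l (\<phi> v) = l v) \<longrightarrow> \<phi> = id)"
    unfolding vertex_distinguishing_def by blast
  then show ?thesis using distinguishing_iff_inj_on by simp
qed

text \<open>An automorphism carries the arc at a leaf \<open>v\<close> to the arc at
  \<open>\<phi> v\<close>, so preserving arc labels means preserving the induced leaf
  labels.\<close>

lemma arc_distinguishing_iff:
  "arc_distinguishing D l \<longleftrightarrow> inj_on (l \<circ> arc_at) A \<and> inj_on (l \<circ> arc_at) B"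
proof -
  have "(\<forall>(u, v)\<in>parcs D. l (\<phi> u, \<phi> v) = l (u, v))
          \<longleftrightarrow> (\<forall>v\<in>A \<union> B. (l \<circ> arc_at) (\<phi> v) = (l \<circ> arc_at) v)"
    if "automorphism D \<phi>" for \<phi>
  proof -
    have "\<phi> c = c" "\<phi> ` A \<subseteq> A" "\<phi> ` B \<subseteq> B" using that automorphism_iff by auto
    then have "(\<lambda>(u, v). (\<phi> u, \<phi> v)) (arc_at v) = arc_at (\<phi> v)" if "v \<in> A \<union> B" for v
      using that disjoint_parts by (auto simp: arc_at_def)
    then show ?thesis unfolding parcs_eq_arc_at by (simp add: case_prod_beta)
  qed
  then have "arc_distinguishing D l \<longleftrightarrow>
      (\<forall>\<phi>. automorphism D \<phi> \<and> (\<forall>v\<in>A \<union> B. (l \<circ> arc_at) (\<phi> v) = (l \<circ> arc_at) v) \<longrightarrow> \<phi> = id)"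
    unfolding arc_distinguishing_def by blast
  then show ?thesis using distinguishing_iff_inj_on[of "l \<circ> arc_at"] by simp
qed

section \<open>The four parameters of one oriented star\<close>

lemma ex_leaf_labelling_iff:
  "(\<exists>f. f ` (A \<union> B) \<subseteq> {1..r::nat} \<and> inj_on f A \<and> inj_on f B) \<longleftrightarrow> max (card A) (card B) \<le> r"
  by (rule ex_labelling_inj_on_parts[OF finite_parts disjoint_parts])

lemma dist_number_oriented_star: "dist_number D = max (card A) (card B)"
proof -
  have "(\<exists>l. vertex_labelling D r l \<and> vertex_distinguishing D l) \<longleftrightarrow> max (card A) (card B) \<le> r"
    (is "?L \<longleftrightarrow> ?R") for r
  proof
    assume ?L
    then show ?R
      unfolding vertex_labelling_def vertex_distinguishing_iff ex_leaf_labelling_iff[symmetric]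
      by auto
  next
    assume R: ?R
    then obtain f where f: "f ` (A \<union> B) \<subseteq> {1..r}" "inj_on f A" "inj_on f B"
      using ex_leaf_labelling_iff by blast
    \<comment> \<open>The centre needs a label too; it may repeat a leaf label, so \<open>1\<close>
      serves as soon as \<open>r\<close> is positive.\<close>
    have "1 \<le> r" using R three_leaves by linarith
    then have "vertex_labelling D r (f(c := 1))"
      using f(1) by (auto simp: vertex_labelling_def)
    moreover have "inj_on (f(c := 1)) A" "inj_on (f(c := 1)) B"
      using f centre_notin by (auto simp: inj_on_def)
    ultimately show ?L using vertex_distinguishing_iff by blast
  qed
  then show ?thesis unfolding dist_number_def by (simp add: Least_equality)
qed

lemma vertex_colouring_iff:
  "vertex_colouring D r l \<longleftrightarrow> vertex_labelling D r l \<and> (\<forall>v\<in>A \<union> B. l v \<noteq> l c)"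
proof -
  have "(\<forall>(u, v)\<in>parcs D. l u \<noteq> l v) \<longleftrightarrow> (\<forall>u v. (u, v) \<in> parcs D \<longrightarrow> l u \<noteq> l v)"
    by blast
  also have "\<dots> \<longleftrightarrow> (\<forall>v\<in>A \<union> B. l v \<noteq> l c)"
    by (simp add: all_conj_distrib) (metis Un_iff)
  finally show ?thesis unfolding vertex_colouring_def by blast
qed

text \<open>The centre is adjacent to all leaves, so its colour is lost to them and the larger part
  must manage with one colour fewer.\<close>

lemma dist_chromatic_number_oriented_star:
  "dist_chromatic_number D = Suc (max (card A) (card B))"
proof -
  have "(\<exists>l. vertex_colouring D r l \<and> vertex_distinguishing D l)
          \<longleftrightarrow> Suc (max (card A) (card B)) \<le> r" (is "?L \<longleftrightarrow> ?R") for r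
  proof
    assume ?L
    then obtain l where l: "vertex_colouring D r l" "inj_on l A" "inj_on l B"
      unfolding vertex_distinguishing_iff by blast
    then have "l c \<in> {1..r}" and img: "l ` A \<subseteq> {1..r} - {l c}" "l ` B \<subseteq> {1..r} - {l c}"
      by (auto simp: vertex_colouring_iff vertex_labelling_def)
    then have "Suc (card ({1..r} - {l c})) = r" by (simp add: card_Diff_singleton)
    moreover have "card A \<le> card ({1..r} - {l c})" "card B \<le> card ({1..r} - {l c})"
      using card_inj_on_le[OF l(2) img(1)] card_inj_on_le[OF l(3) img(2)] by simp_all
    ultimately show ?R by linarith
  next
    assume R: ?R
    \<comment> \<open>The leaves are coloured from \<open>{1..k}\<close>, which reserves the last
      colour \<open>r\<close> for the centre.\<close>
    then obtain k where k: "r = Suc k" "max (card A) (card B) \<le> k" by (cases r) auto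
    then obtain f where f: "f ` (A \<union> B) \<subseteq> {1..k}" "inj_on f A" "inj_on f B"
      using ex_leaf_labelling_iff by blast
    have inj: "inj_on (f(c := r)) A" "inj_on (f(c := r)) B"
      using f centre_notin by (auto simp: inj_on_def)
    have range: "1 \<le> f v \<and> f v < r" if "v \<in> A \<union> B" for v
    proof -
      have "f v \<in> {1..k}" using f(1) that by blast
      then show ?thesis using k(1) by simp
    qed
    have "vertex_labelling D r (f(c := r))"
      unfolding vertex_labelling_def
    proof
      fix x assume "x \<in> (f(c := r)) ` pverts D"
      then obtain v where "x = (f(c := r)) v" "v \<in> insert c (A \<union> B)"
        unfolding pverts_oriented_star by (rule imageE)
      then show "x \<in> {1..r}" using range[of v] k(1) by (cases "v = c") simp_all
    qed
    moreover have "\<forall>v\<in>A \<union> B. (f(c := r)) v \<noteq> (f(c := r)) c"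
      using range centre_notin by (metis Un_iff fun_upd_apply less_irrefl)
    ultimately have "vertex_colouring D r (f(c := r))"
      unfolding vertex_colouring_iff by blast
    then show ?L using inj vertex_distinguishing_iff by blast
  qed
  then show ?thesis unfolding dist_chromatic_number_def by (simp add: Least_equality)
qed

text \<open>Since \<open>arc_at\<close> is injective on the leaves, every leaf labelling comes from
  an arc labelling, up to its values off the leaves; \<open>cong\<close> says that \<open>P\<close>
  ignores those values.\<close>

lemma ex_arc_labelling_iff:
  "(\<exists>l. P (l \<circ> arc_at)) \<longleftrightarrow> (\<exists>f. P f)"
  if cong: "\<And>f g. (\<And>v. v \<in> A \<union> B \<Longrightarrow> f v = g v) \<Longrightarrow> P f = P g"
proof
  assume "\<exists>f. P f"
  then obtain f where "P f" ..
  moreover have "P f \<longleftrightarrow> P ((f \<circ> inv_into (A \<union> B) arc_at) \<circ> arc_at)"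
    by (rule cong) (simp add: inv_into_f_f[OF inj_on_arc_at])
  ultimately show "\<exists>l. P (l \<circ> arc_at)" by blast
qed blast

lemma arc_labelling_iff: "arc_labelling D r l \<longleftrightarrow> (l \<circ> arc_at) ` (A \<union> B) \<subseteq> {1..r}"
  by (simp only: arc_labelling_def parcs_eq_arc_at image_comp)

lemma dist_index_oriented_star: "dist_index D = max (card A) (card B)"
proof -
  have "(\<exists>l. arc_labelling D r l \<and> arc_distinguishing D l) \<longleftrightarrow> max (card A) (card B) \<le> r" for r
    unfolding arc_labelling_iff arc_distinguishing_iff ex_leaf_labelling_iff[symmetric]
    by (rule ex_arc_labelling_iff) (auto cong: inj_on_cong image_cong)
  then show ?thesis unfolding dist_index_def by (simp add: Least_equality)
qed

text \<open>Any two arcs meet in the centre, so a proper colouring gives all arcs different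
  labels.\<close>

lemma arc_colouring_iff:
  "arc_colouring D r l \<longleftrightarrow> (l \<circ> arc_at) ` (A \<union> B) \<subseteq> {1..r} \<and> inj_on (l \<circ> arc_at) (A \<union> B)"
proof -
  have "{fst e, snd e} \<inter> {fst f, snd f} \<noteq> {}" if "e \<in> parcs D" "f \<in> parcs D" for e f
    using that by auto
  then have "arc_colouring D r l \<longleftrightarrow> arc_labelling D r l \<and> inj_on l (arc_at ` (A \<union> B))"
    unfolding arc_colouring_def inj_on_def parcs_eq_arc_at[symmetric] by blast
  then show ?thesis
    unfolding arc_labelling_iff by (simp add: comp_inj_on_iff[OF inj_on_arc_at])
qed

text \<open>Injectivity on all leaves implies injectivity on each part, so every arc colouring is
  distinguishing and only the number of arcs counts.\<close>

lemma dist_chromatic_index_oriented_star: "dist_chromatic_index D = card A + card B"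
proof -
  have "(\<exists>l. arc_colouring D r l \<and> arc_distinguishing D l)
          \<longleftrightarrow> (\<exists>l. (l \<circ> arc_at) ` (A \<union> B) \<subseteq> {1..r} \<and> inj_on (l \<circ> arc_at) (A \<union> B))" for r
    unfolding arc_colouring_iff arc_distinguishing_iff by (auto simp: inj_on_Un)
  also have "\<dots> r \<longleftrightarrow> (\<exists>f. f ` (A \<union> B) \<subseteq> {1..r} \<and> inj_on f (A \<union> B))" for r
    by (rule ex_arc_labelling_iff) (metis (no_types, lifting) image_cong inj_on_cong)
  also have "\<dots> r \<longleftrightarrow> card (A \<union> B) \<le> r" for r
    \<comment> \<open>With an empty second part, the two-part criterion becomes the count for a
      single set.\<close>
    using ex_labelling_inj_on_parts[of "A \<union> B" "{}" r] finite_parts by simp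
  finally show ?thesis
    using card_Un_disjoint[OF finite_parts disjoint_parts]
    unfolding dist_chromatic_index_def by (simp add: Least_equality)
qed

end

section \<open>Minimum and maximum over all orientations of the star\<close>

lemma orientations_of_star:
  assumes "pverts G = insert c V" "parcs G = {c} \<times> V \<union> V \<times> {c}" "c \<notin> V"
  shows "{D. orientation G D} = (\<lambda>A. oriented_star c A (V - A)) ` Pow V"
proof (intro set_eqI iffI)
  fix D assume "D \<in> {D. orientation G D}"
  then have ori: "pverts D = pverts G" "parcs D \<subseteq> parcs G"
    "\<And>u v. (u, v) \<in> parcs G \<Longrightarrow> (u, v) \<in> parcs D \<longleftrightarrow> (v, u) \<notin> parcs D"
    by (auto simp: orientation_def)
  \<comment> \<open>Exactly one arc of each edge is chosen, so the out-neighbours of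
    \<open>c\<close> determine the orientation.\<close>
  define A where "A = {v \<in> V. (c, v) \<in> parcs D}"
  have "(c, v) \<in> parcs D \<longleftrightarrow> (v, c) \<notin> parcs D" if "v \<in> V" for v
    using ori(3)[of c v] that assms(2) by auto
  then have "parcs D = {c} \<times> A \<union> (V - A) \<times> {c}"
    using ori(2) assms(2,3) unfolding A_def by auto
  moreover have "pverts D = insert c (A \<union> (V - A))"
    using ori(1) assms(1) by (auto simp: A_def)
  ultimately have "D = oriented_star c A (V - A)" by (simp add: oriented_star_def)
  moreover have "A \<in> Pow V" by (auto simp: A_def)
  ultimately show "D \<in> (\<lambda>A. oriented_star c A (V - A)) ` Pow V" by blast
next
  fix D assume "D \<in> (\<lambda>A. oriented_star c A (V - A)) ` Pow V"
  then show "D \<in> {D. orientation G D}"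
    using assms by (auto simp: orientation_def)
qed

lemma card_image_Pow:
  assumes "finite V"
  shows "card ` Pow V = {..card V}"
proof
  show "card ` Pow V \<subseteq> {..card V}" using assms by (auto intro: card_mono)
  show "{..card V} \<subseteq> card ` Pow V"
  proof
    fix k assume "k \<in> {..card V}"
    then obtain A where "A \<subseteq> V" "card A = k"
      using obtain_subset_with_card_n[of k V] by auto
    then show "k \<in> card ` Pow V" by auto
  qed
qed

text \<open>The function \<open>g\<close> captures how a parameter depends on the larger part. By
  monotonicity it suffices to minimise and maximise \<open>max i (card V - i)\<close> over
  \<open>i \<le> card V\<close>.\<close>

lemma orient_min_max_star:
  fixes g :: "nat \<Rightarrow> nat"
  assumes "finite V" "pverts G = insert c V" "parcs G = {c} \<times> V \<union> V \<times> {c}" "c \<notin> V"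
    and p: "\<And>A. A \<subseteq> V \<Longrightarrow> p (oriented_star c A (V - A)) = g (max (card A) (card (V - A)))"
    and "mono g"
  shows "orient_min p G = g ((card V + 1) div 2)" "orient_max p G = g (card V)"
proof -
  let ?n = "card V" and ?k = "\<lambda>i. max i (card V - i)"
  have "p ` {D. orientation G D} = (\<lambda>A. g (?k (card A))) ` Pow V"
    using p assms(1) unfolding orientations_of_star[OF assms(2-4)] image_image
    by (intro image_cong) (auto simp: card_Diff_subset finite_subset)
  \<comment> \<open>Only the size of \<open>A\<close> matters, and every size from 0 to
    \<open>?n\<close> occurs.\<close>
  also have "\<dots> = (\<lambda>i. g (?k i)) ` {..?n}"
    unfolding card_image_Pow[OF assms(1), symmetric] image_image ..
  finally have im: "p ` {D. orientation G D} = (\<lambda>i. g (?k i)) ` {..?n}" .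
  \<comment> \<open>The balanced split, rounded up: the other part is no larger, so
    \<open>?k i = i\<close>.\<close>
  have mem: "g ((?n + 1) div 2) \<in> (\<lambda>i. g (?k i)) ` {..?n}"
    by (rule rev_image_eqI[of "(?n + 1) div 2"]) (auto intro: arg_cong[where f = g])
  \<comment> \<open>The one-sided orientation, with every leaf an out-neighbour of the
    centre.\<close>
  have mem': "g ?n \<in> (\<lambda>i. g (?k i)) ` {..?n}"
    by (rule rev_image_eqI[of ?n]) auto
  have bounds: "(?n + 1) div 2 \<le> ?k i" "i \<le> ?n \<Longrightarrow> ?k i \<le> ?n" for i by auto
  show "orient_min p G = g ((?n + 1) div 2)"
    unfolding orient_min_def im using mem bounds \<open>mono g\<close>
    by (intro Min_eqI) (auto intro: monoD)
  show "orient_max p G = g ?n"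
    unfolding orient_max_def im using mem' bounds \<open>mono g\<close>
    by (intro Max_eqI) (auto intro: monoD)
qed

theorem theorem9:
  fixes G :: "'a pair_pre_digraph" and n :: nat
  assumes "n \<ge> 3" and "K\<^bsub>1,n\<^esub> (with_proj G)"
  shows "D_min G = nat \<lceil>real n / 2\<rceil> \<and> D'_min G = nat \<lceil>real n / 2\<rceil> \<and>
         D_max G = n \<and> D'_max G = n \<and>
         chi_D_min G = 1 + nat \<lceil>real n / 2\<rceil> \<and> chi_D_max G = n + 1 \<and>
         chi'_D_min G = n \<and> chi'_D_max G = n"
proof -
  obtain U V where UV: "pverts G = U \<union> V" "U \<inter> V = {}" "card U = 1" "card V = n"
    "parcs G = U \<times> V \<union> V \<times> U" "finite (pverts G)"
    using assms(2) unfolding complete_bipartite_digraph_pair_def by blast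
  then obtain c where "U = {c}" by (meson card_1_singletonE)
  then have G: "finite V" "pverts G = insert c V" "parcs G = {c} \<times> V \<union> V \<times> {c}" "c \<notin> V"
    using UV by auto
  have split: "card A + card (V - A) = n" if "A \<subseteq> V" for A
    using card_Un_disjoint[of A "V - A"] that G(1) UV(4)
    by (simp add: Un_absorb1 finite_subset)
  have star: "star_orientation c A (V - A)" if "A \<subseteq> V" for A
    using that G split[OF that] assms(1) by unfold_locales (auto intro: finite_subset)
  note params = star_orientation.dist_number_oriented_star[OF star]
    star_orientation.dist_index_oriented_star[OF star]
    star_orientation.dist_chromatic_number_oriented_star[OF star]
    star_orientation.dist_chromatic_index_oriented_star[OF star]
  note bounds = orient_min_max_star[OF G, unfolded UV(4)]
  have "D_min G = (n + 1) div 2" "D_max G = n"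
    by (rule bounds[where g = "\<lambda>k. k"]; simp add: params mono_def)+
  moreover have "D'_min G = (n + 1) div 2" "D'_max G = n"
    by (rule bounds[where g = "\<lambda>k. k"]; simp add: params mono_def)+
  moreover have "chi_D_min G = Suc ((n + 1) div 2)" "chi_D_max G = Suc n"
    by (rule bounds[where g = Suc]; simp add: params mono_def)+
  \<comment> \<open>Here \<open>g\<close> is constant: the two parts always add up to
    \<open>n\<close>, whatever the orientation.\<close>
  moreover have "chi'_D_min G = n" "chi'_D_max G = n"
    by (rule bounds[where g = "\<lambda>_. n"]; simp add: params split mono_def)+
  moreover have "nat \<lceil>real n / 2\<rceil> = (n + 1) div 2" by linarith
  ultimately show ?thesis by simp
qed

end
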